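(* Let $M=(X,\Sigma,\delta,x_0)$ be a deterministic finite state machine over $\Sigma=\Sigma_c\,\dot\cup\,\Sigma_{uc}$ such that for all $x\in X$ and $\sigma,\sigma'\in\Sigma$ with $\delta(x,\sigma),\delta(x,\sigma')$ defined, $\delta(x,\sigma)=\delta(x,\sigma')$ implies $\sigma=\sigma'$. Let $\mathcal{F}^S_P=\{(G_1,R_1),\dots,(G_l,R_l)\}$ be a Streett condition and $\mathcal{F}^R_S=\{(G'_1,R'_1),\dots,(G'_k,R'_k)\}$ a Rabin condition over $M$, and let $\mathcal{F}^R_{P\to S}=\{(G_1,R_1),\dots,(G_l,R_l),(G'_1,R'_1),\dots,(G'_k,R'_k)\}$, read as a Rabin condition. Then there exists a path-based supervisor $\check f:P(M)\to\Gamma$ satisfying (1) $\emptyset\subsetneq\mathcal{P}(M,\check f)\cap\mathcal{P}(M,\mathcal{F}^S_P)\subseteq\mathcal{P}(M,\mathcal{F}^R_S)$ and (2) $P(M,\check f)\subseteq\mathrm{Pre}(\mathcal{P}(M,\check f)\cap\mathcal{P}(M,\mathcal{F}^S_P))$, if and only if there exists a player-0 strategy $h$ on the game graph $G(M)$ such that (i) every infinite play of $G(M)$ compliant with $h$ satisfies the Rabin condition $\mathcal{F}^R_{P\to S}$, and (ii) every finite play of $G(M)$ compliant with $h$ is a prefix of some infinite play of $G(M)$ compliant with $h$ that satisfies the Streett condition $\mathcal{F}^S_P$.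
   Context: $\Gamma=\{\gamma\subseteq\Sigma:\Sigma_{uc}\subseteq\gamma\}$. Finite state machine $M=(X,\Sigma,\delta,x_0)$: finite $X$, partial $\delta:X\times\Sigma\rightharpoonup 2^X$, deterministic meaning each defined $\delta(x,\sigma)$ is a singleton. A path is a finite or infinite sequence $x_0x_1\dots$ starting at $x_0$ with $x_{k+1}\in\delta(x_k,\sigma_k)$ for some $\sigma_k$; $P(M)$ and $\mathcal{P}(M)$ denote finite and infinite paths. For an infinite sequence $\pi$ of states, $\mathrm{Inf}(\pi)$ is the set of states occurring infinitely often. A sequence satisfies the Rabin condition $\{(G_i,R_i)\}_i$ if some $i$ has $\mathrm{Inf}\cap G_i\ne\emptyset$ and $\mathrm{Inf}\cap R_i=\emptyset$; it satisfies the Streett condition $\{(G_i,R_i)\}_i$ if every $i$ has $\mathrm{Inf}\cap G_i=\emptyset$ or $\mathrm{Inf}\cap R_i\neq\emptyset$. $\mathcal{P}(M,\mathcal{F})$ is the set of infinite paths satisfying $\mathcal{F}$. For a set $A$ of sequences, $\mathrm{Pre}(A)$ is the set of finite prefixes of its elements, and $\mathrm{Lim}(B)$ for a set $B$ of finite sequences is the set of infinite sequences with infinitely many prefixes in $B$. Path-based supervisor: a map $\check f:P(M)\to\Gamma$; a path $\pi$ is consistent with $\check f$ if for all $\nu\in X^*$, $x,x'\in X$ with $\nu x x'$ a prefix of $\pi$ there is $\sigma\in\check f(\nu x)$ with $\delta(x,\sigma)=\{x'\}$; $P(M,\check f)$ is the set of finite consistent paths and $\mathcal{P}(M,\check f)=\mathrm{Lim}(P(M,\check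 f))$. Game graphs: $G=(Q^0,Q^1,\delta^0,\delta^1,q_{init})$ with disjoint finite $Q^0,Q^1$, $\delta^0:Q^0\to2^{Q^1}$, $\delta^1:Q^1\to 2^{Q^0}$, $q_{init}\in Q^0$; $Q=Q^0\cup Q^1$. A play is a finite or infinite sequence $\rho$ over $Q$ with $\rho(0)=q_{init}$ and $\rho(k+1)\in\delta^0(\rho(k))$ if $\rho(k)\in Q^0$, $\rho(k+1)\in\delta^1(\rho(k))$ if $\rho(k)\in Q^1$. A player-0 strategy is a function $h:q_{init}(Q^1Q^0)^*\to Q^1$ (choosing a successor of the last state); a play $\rho$ is compliant with $h$ if $\rho(k+1)=h(\rho(0)\dots\rho(k))$ whenever $\rho(k)\in Q^0$. Winning conditions on plays are Rabin/Streett conditions applied to $\mathrm{Inf}(\rho)$ with sets of states of $Q$. Associated game graph $G(M)$: $Q^0=X$, $Q^1=X\times\Gamma$, $q_{init}=x_0$, $\delta^0(x)=\{x\}\times\Gamma$, and $x'\in\delta^1((x,\gamma))$ iff there is $\sigma\in\gamma$ with $\delta(x,\sigma)$ defined and $x'\in\delta(x,\sigma)$. Conditions over $M$ (sets of subsets of $X=Q^0$) are read as conditions over $G(M)$. *)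

theory Defs
  imports "HOL-Library.Sublist" "HOL-Library.Omega_Words_Fun"
begin

text \<open>Finite sequences are lists, infinite sequences are functions on \<^typ>\<open>nat\<close>;
  the set of elements occurring infinitely often in \<open>w\<close> is \<^term>\<open>limit w\<close>.\<close>

definition Pre :: "'a word set \<Rightarrow> 'a list set" where
  "Pre A = {w [0 \<rightarrow> n] | w n. w \<in> A}"

definition Lim :: "'a list set \<Rightarrow> 'a word set" where
  "Lim B = {w. infinite {v \<in> B. \<exists>n. v = w [0 \<rightarrow> n]}}"

type_synonym 'q acc_cond = "('q set \<times> 'q set) set"

definition cond_over :: "'q set \<Rightarrow> 'q acc_cond \<Rightarrow> bool" where
  "cond_over Q F \<longleftrightarrow> finite F \<and> (\<forall>(G, R) \<in> F. G \<subseteq> Q \<and> R \<subseteq> Q)"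

definition rabin :: "'q acc_cond \<Rightarrow> 'q word \<Rightarrow> bool" where
  "rabin F w \<longleftrightarrow> (\<exists>(G, R) \<in> F. limit w \<inter> G \<noteq> {} \<and> limit w \<inter> R = {})"

definition streett :: "'q acc_cond \<Rightarrow> 'q word \<Rightarrow> bool" where
  "streett F w \<longleftrightarrow> (\<forall>(G, R) \<in> F. limit w \<inter> G = {} \<or> limit w \<inter> R \<noteq> {})"


text \<open>The transition function is partial: \<^term>\<open>None\<close> means undefined. Its values outside
  \<open>states \<times> events\<close> are irrelevant.\<close>

record ('x, 'e) fsm =
  states :: "'x set"
  events :: "'e set"
  delta :: "'x \<Rightarrow> 'e \<Rightarrow> 'x set option"
  start :: 'x

definition fsm :: "('x, 'e) fsm \<Rightarrow> bool" where
  "fsm M \<longleftrightarrow> finite (states M) \<and> finite (events M) \<and> start M \<in> states M \<and>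
     (\<forall>x \<in> states M. \<forall>\<sigma> \<in> events M. \<forall>S. delta M x \<sigma> = Some S \<longrightarrow> S \<subseteq> states M)"

definition deterministic :: "('x, 'e) fsm \<Rightarrow> bool" where
  "deterministic M \<longleftrightarrow>
     (\<forall>x \<in> states M. \<forall>\<sigma> \<in> events M. \<forall>S. delta M x \<sigma> = Some S \<longrightarrow> (\<exists>x'. S = {x'}))"

definition step :: "('x, 'e) fsm \<Rightarrow> 'x \<Rightarrow> 'x \<Rightarrow> bool" where
  "step M x x' \<longleftrightarrow> (\<exists>\<sigma> \<in> events M. \<exists>S. delta M x \<sigma> = Some S \<and> x' \<in> S)"

definition fin_paths :: "('x, 'e) fsm \<Rightarrow> 'x list set" where
  "fin_paths M = {p. p \<noteq> [] \<and> p ! 0 = start M \<and>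
     (\<forall>k. Suc k < length p \<longrightarrow> step M (p ! k) (p ! Suc k))}"

definition inf_paths :: "('x, 'e) fsm \<Rightarrow> 'x word set" where
  "inf_paths M = {\<pi>. \<pi> 0 = start M \<and> (\<forall>k. step M (\<pi> k) (\<pi> (Suc k)))}"

definition control_patterns :: "'e set \<Rightarrow> 'e set \<Rightarrow> 'e set set" where
  "control_patterns E Euc = {\<gamma>. \<gamma> \<subseteq> E \<and> Euc \<subseteq> \<gamma>}"

text \<open>A supervisor is only constrained on (and only ever evaluated at) finite paths.\<close>

definition supervisor :: "('x, 'e) fsm \<Rightarrow> 'e set \<Rightarrow> ('x list \<Rightarrow> 'e set) \<Rightarrow> bool" where
  "supervisor M Euc f \<longleftrightarrow> (\<forall>p \<in> fin_paths M. f p \<in> control_patterns (events M) Euc)"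

definition consistent :: "('x, 'e) fsm \<Rightarrow> ('x list \<Rightarrow> 'e set) \<Rightarrow> 'x list \<Rightarrow> bool" where
  "consistent M f p \<longleftrightarrow> (\<forall>\<nu> x x'. Sublist.prefix (\<nu> @ [x, x']) p \<longrightarrow>
     (\<exists>\<sigma> \<in> f (\<nu> @ [x]). delta M x \<sigma> = Some {x'}))"

definition sup_fin_paths :: "('x, 'e) fsm \<Rightarrow> ('x list \<Rightarrow> 'e set) \<Rightarrow> 'x list set" where
  "sup_fin_paths M f = {p \<in> fin_paths M. consistent M f p}"

definition sup_inf_paths :: "('x, 'e) fsm \<Rightarrow> ('x list \<Rightarrow> 'e set) \<Rightarrow> 'x word set" where
  "sup_inf_paths M f = Lim (sup_fin_paths M f)"


record 'q game =
  Q0 :: "'q set"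
  Q1 :: "'q set"
  \<delta>0 :: "'q \<Rightarrow> 'q set"
  \<delta>1 :: "'q \<Rightarrow> 'q set"
  q_init :: 'q

definition game_graph :: "'q game \<Rightarrow> bool" where
  "game_graph G \<longleftrightarrow> finite (Q0 G) \<and> finite (Q1 G) \<and> Q0 G \<inter> Q1 G = {} \<and>
     (\<forall>q \<in> Q0 G. \<delta>0 G q \<subseteq> Q1 G) \<and> (\<forall>q \<in> Q1 G. \<delta>1 G q \<subseteq> Q0 G) \<and> q_init G \<in> Q0 G"

definition move :: "'q game \<Rightarrow> 'q \<Rightarrow> 'q \<Rightarrow> bool" where
  "move G q q' \<longleftrightarrow> (q \<in> Q0 G \<longrightarrow> q' \<in> \<delta>0 G q) \<and> (q \<in> Q1 G \<longrightarrow> q' \<in> \<delta>1 G q)"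

definition fin_plays :: "'q game \<Rightarrow> 'q list set" where
  "fin_plays G = {\<rho>. \<rho> \<noteq> [] \<and> set \<rho> \<subseteq> Q0 G \<union> Q1 G \<and> \<rho> ! 0 = q_init G \<and>
     (\<forall>k. Suc k < length \<rho> \<longrightarrow> move G (\<rho> ! k) (\<rho> ! Suc k))}"

definition inf_plays :: "'q game \<Rightarrow> 'q word set" where
  "inf_plays G = {\<rho>. range \<rho> \<subseteq> Q0 G \<union> Q1 G \<and> \<rho> 0 = q_init G \<and>
     (\<forall>k. move G (\<rho> k) (\<rho> (Suc k)))}"

text \<open>The language \<open>q_init (Q1 Q0)*\<close>, the domain of player-0 strategies.\<close>

inductive_set histories :: "'q game \<Rightarrow> 'q list set" for G where
  init: "[q_init G] \<in> histories G"
| ext: "s \<in> histories G \<Longrightarrow> q1 \<in> Q1 G \<Longrightarrow> q0 \<in> Q0 G \<Longrightarrow> s @ [q1, q0] \<in> histories G"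

definition strategy0 :: "'q game \<Rightarrow> ('q list \<Rightarrow> 'q) \<Rightarrow> bool" where
  "strategy0 G h \<longleftrightarrow> (\<forall>s \<in> histories G. h s \<in> Q1 G \<and> h s \<in> \<delta>0 G (last s))"

definition compliant_fin_plays :: "'q game \<Rightarrow> ('q list \<Rightarrow> 'q) \<Rightarrow> 'q list set" where
  "compliant_fin_plays G h = {\<rho> \<in> fin_plays G.
     \<forall>k. Suc k < length \<rho> \<and> \<rho> ! k \<in> Q0 G \<longrightarrow> \<rho> ! Suc k = h (take (Suc k) \<rho>)}"

definition compliant_inf_plays :: "'q game \<Rightarrow> ('q list \<Rightarrow> 'q) \<Rightarrow> 'q word set" where
  "compliant_inf_plays G h = {\<rho> \<in> inf_plays G.
     \<forall>k. \<rho> k \<in> Q0 G \<longrightarrow> \<rho> (Suc k) = h (\<rho> [0 \<rightarrow> Suc k])}"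


text \<open>The game graph of a machine: the state \<open>x\<close> of player 0 is \<open>Inl x\<close>, the state
  \<open>(x, \<gamma>)\<close> of player 1 is \<open>Inr (x, \<gamma>)\<close>.\<close>

definition game_of :: "('x, 'e) fsm \<Rightarrow> 'e set \<Rightarrow> ('x + 'x \<times> 'e set) game" where
  "game_of M Euc = \<lparr>
     Q0 = Inl ` states M,
     Q1 = Inr ` (states M \<times> control_patterns (events M) Euc),
     \<delta>0 = (\<lambda>q. case q of
             Inl x \<Rightarrow> Inr ` ({x} \<times> control_patterns (events M) Euc)
           | Inr _ \<Rightarrow> {}),
     \<delta>1 = (\<lambda>q. case q of
             Inl _ \<Rightarrow> {}
           | Inr (x, \<gamma>) \<Rightarrow> Inl ` {x'. \<exists>\<sigma> \<in> \<gamma>. \<exists>S. delta M x \<sigma> = Some S \<and> x' \<in> S}),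
     q_init = Inl (start M) \<rparr>"

definition lift_cond :: "'x acc_cond \<Rightarrow> ('x + 'y) acc_cond" where
  "lift_cond F = (\<lambda>(G, R). (Inl ` G, Inl ` R)) ` F"

lemma game_graph_game_of:
  assumes "fsm M"
  shows "game_graph (game_of M Euc)"
proof -
  let ?C = "control_patterns (events M) Euc"
  have "?C \<subseteq> Pow (events M)"
    by (auto simp: control_patterns_def)
  then have fin: "finite ?C"
    using assms by (meson finite_Pow_iff finite_subset fsm_def)
  have closed: "S \<subseteq> states M" if "x \<in> states M" "\<gamma> \<in> ?C" "\<sigma> \<in> \<gamma>" "delta M x \<sigma> = Some S" for x \<gamma> \<sigma> S
    using assms that unfolding fsm_def control_patterns_def by blast
  have "\<forall>q \<in> Q1 (game_of M Euc). \<delta>1 (game_of M Euc) q \<subseteq> Q0 (game_of M Euc)"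
    using closed by (auto simp: game_of_def subset_iff)
  then show ?thesis
    using assms fin by (auto simp: game_graph_def game_of_def fsm_def)
qed

end

theory Submission
  imports Defs
begin

text \<open>A strategy \<open>h\<close> turns every path \<open>x\<^sub>0 x\<^sub>1 \<dots>\<close> of the machine into the play
  \<open>x\<^sub>0 (x\<^sub>0, \<gamma>\<^sub>0) x\<^sub>1 (x\<^sub>1, \<gamma>\<^sub>1) \<dots>\<close> in which player 0 follows \<open>h\<close>. If \<open>h\<close> answers this play with
  the control pattern that the supervisor \<open>f\<close> picks after the underlying path, then the paths
  consistent with \<open>f\<close> are exactly the paths underlying plays compliant with \<open>h\<close>, and Rabin and
  Streett conditions over the machine do not see the states of player 1. Since a Streett
  condition is the negation of the Rabin condition with the same pairs, condition (i) says
  that Streett paths satisfy the Rabin specification. It remains to see that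
  each supervisor has such a matching strategy and conversely.\<close>

section \<open>Plays induced by paths, and acceptance conditions along them\<close>

primrec rev_play :: "(('x + 'y) list \<Rightarrow> 'x + 'y) \<Rightarrow> 'x list \<Rightarrow> ('x + 'y) list" where
  "rev_play h [] = []"
| "rev_play h (x # p) = (if p = [] then [] else rev_play h p @ [h (rev_play h p)]) @ [Inl x]"

text \<open>An answer depends on everything before it, while \<open>primrec\<close> peels the head;
  so \<open>rev_play\<close> recurses over the reversed path. The play stops at the last state,
  before the answer to it.\<close>

definition play_of :: "(('x + 'y) list \<Rightarrow> 'x + 'y) \<Rightarrow> 'x list \<Rightarrow> ('x + 'y) list" where
  "play_of h p = rev_play h (rev p)"

text \<open>Given in closed form by position rather than as a limit of finite plays; the lemmas on
  prefixes of odd and even length recover that it is this limit.\<close>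

definition inf_play_of :: "(('x + 'y) list \<Rightarrow> 'x + 'y) \<Rightarrow> 'x word \<Rightarrow> ('x + 'y) word" where
  "inf_play_of h \<pi> n =
     (if even n then Inl (\<pi> (n div 2)) else h (play_of h (prefix (Suc (n div 2)) \<pi>)))"

text \<open>Forgets the answers, provided that they lie in the \<open>Inr\<close> summand. It
  recovers a path from its play and also applies to histories that are not plays.\<close>

definition path_of :: "('x + 'y) list \<Rightarrow> 'x list" where
  "path_of s = map projl (filter isl s)"

lemma play_of_singleton [simp]: "play_of h [x] = [Inl x]"
  by (simp add: play_of_def)

lemma play_of_snoc: "p \<noteq> [] \<Longrightarrow> play_of h (p @ [x]) = play_of h p @ [h (play_of h p), Inl x]"
  by (simp add: play_of_def)

lemma last_play_of: "p \<noteq> [] \<Longrightarrow> last (play_of h p) = Inl (last p)"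
  by (cases p rule: rev_cases) (auto simp: play_of_def)

lemma play_of_nonempty: "p \<noteq> [] \<Longrightarrow> play_of h p \<noteq> []"
  by (cases p rule: rev_cases) (auto simp: play_of_def)

text \<open>One answer stands between any two consecutive states and none after the last;
  \<open>Suc\<close> avoids truncated subtraction. This fixes where in an infinite play a given
  finite one can end.\<close>

lemma length_play_of: "p \<noteq> [] \<Longrightarrow> Suc (length (play_of h p)) = 2 * length p"
proof (induction p rule: rev_induct)
  case (snoc x p)
  then show ?case by (cases "p = []") (auto simp: play_of_snoc)
qed simp

lemma prefix_Suc: "prefix (Suc n) w = prefix n w @ [w n]"
  by (simp add: subsequence_def)

lemma prefix_inf_play_of_odd: "prefix (Suc (2 * k)) (inf_play_of h \<pi>) = play_of h (prefix (Suc k) \<pi>)"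
proof (induction k)
  case 0
  then show ?case by (simp add: prefix_Suc inf_play_of_def)
next
  case (Suc k)
  have "prefix (Suc (2 * Suc k)) (inf_play_of h \<pi>) =
      prefix (Suc (2 * k)) (inf_play_of h \<pi>) @ [inf_play_of h \<pi> (Suc (2 * k)), Inl (\<pi> (Suc k))]"
    by (simp add: prefix_Suc) (simp add: inf_play_of_def)
  also have "\<dots> = play_of h (prefix (Suc k) \<pi>) @ [h (play_of h (prefix (Suc k) \<pi>)), Inl (\<pi> (Suc k))]"
    unfolding Suc.IH by (simp add: inf_play_of_def)
  also have "\<dots> = play_of h (prefix (Suc k) \<pi> @ [\<pi> (Suc k)])"
    by (rule play_of_snoc [symmetric]) simp
  finally show ?case by (simp only: prefix_Suc)
qed

lemma prefix_inf_play_of_even: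
  "prefix (2 * Suc k) (inf_play_of h \<pi>) =
     play_of h (prefix (Suc k) \<pi>) @ [h (play_of h (prefix (Suc k) \<pi>))]"
proof -
  have "prefix (2 * Suc k) (inf_play_of h \<pi>) =
      prefix (Suc (2 * k)) (inf_play_of h \<pi>) @ [inf_play_of h \<pi> (Suc (2 * k))]"
    by (simp add: prefix_Suc)
  then show ?thesis
    by (simp add: prefix_inf_play_of_odd) (simp add: inf_play_of_def)
qed

text \<open>With all answers in the \<open>Inr\<close> summand, \<open>Inl a\<close> occurs at even
  positions only, and doubling maps the positions of \<open>a\<close> in the path injectively onto
  them.\<close>

lemma limit_inf_play_of:
  assumes "\<And>k. \<not> isl (h (play_of h (prefix (Suc k) \<pi>)))"
  shows "Inl a \<in> limit (inf_play_of h \<pi>) \<longleftrightarrow> a \<in> limit \<pi>"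
proof -
  have "{n. inf_play_of h \<pi> n = Inl a} = (\<lambda>n. 2 * n) ` {n. \<pi> n = a}"
  proof (intro set_eqI iffI)
    fix n assume "n \<in> {n. inf_play_of h \<pi> n = Inl a}"
    then have "even n \<and> \<pi> (n div 2) = a"
      using assms [of "n div 2"] by (auto simp: inf_play_of_def split: if_splits)
    then show "n \<in> (\<lambda>n. 2 * n) ` {n. \<pi> n = a}"
      by (auto intro!: image_eqI [where x = "n div 2"])
  qed (auto simp: inf_play_of_def)
  moreover have "infinite ((\<lambda>n::nat. 2 * n) ` {n. \<pi> n = a}) \<longleftrightarrow> infinite {n. \<pi> n = a}"
    by (subst finite_image_iff) (auto simp: inj_on_def)
  ultimately show ?thesis
    by (simp add: limit_def INFM_iff_infinite)
qed

lemma lift_cond_inf_play_of: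
  assumes "\<And>k. \<not> isl (h (play_of h (prefix (Suc k) \<pi>)))"
  shows rabin_inf_play_of: "rabin (lift_cond F) (inf_play_of h \<pi>) \<longleftrightarrow> rabin F \<pi>"
    and streett_inf_play_of: "streett (lift_cond F) (inf_play_of h \<pi>) \<longleftrightarrow> streett F \<pi>"
proof -
  have "limit (inf_play_of h \<pi>) \<inter> Inl ` A = Inl ` (limit \<pi> \<inter> A)" for A
    using limit_inf_play_of [of h \<pi>, OF assms] by auto
  then show "rabin (lift_cond F) (inf_play_of h \<pi>) \<longleftrightarrow> rabin F \<pi>"
    and "streett (lift_cond F) (inf_play_of h \<pi>) \<longleftrightarrow> streett F \<pi>"
    by (auto simp: rabin_def streett_def lift_cond_def split_beta)
qed

lemma rabin_Un: "rabin (F \<union> F') w \<longleftrightarrow> rabin F w \<or> rabin F' w"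
  by (simp add: rabin_def bex_Un)

lemma streett_iff_not_rabin: "streett F w \<longleftrightarrow> \<not> rabin F w"
  by (auto simp: rabin_def streett_def)

section \<open>Finite paths, consistency and limits of supervised paths\<close>

lemma all_Suc_less_snoc:
  assumes "p \<noteq> []"
  shows "(\<forall>k. Suc k < length (p @ [x]) \<longrightarrow> P k ((p @ [x]) ! k) ((p @ [x]) ! Suc k)) \<longleftrightarrow>
    (\<forall>k. Suc k < length p \<longrightarrow> P k (p ! k) (p ! Suc k)) \<and> P (length p - 1) (last p) x"
proof -
  obtain n where n: "length p = Suc n" using assms by (cases p) auto
  have "last p = p ! n" using assms n by (simp add: last_conv_nth)
  then show ?thesis using n
    by (auto simp: nth_append less_Suc_eq all_conj_distrib)
qed

lemma fin_paths_singleton: "[x] \<in> fin_paths M \<longleftrightarrow> x = start M"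
  by (auto simp: fin_paths_def)

lemma fin_paths_snoc:
  "p \<noteq> [] \<Longrightarrow> p @ [x] \<in> fin_paths M \<longleftrightarrow> p \<in> fin_paths M \<and> step M (last p) x"
  using all_Suc_less_snoc [of p x "\<lambda>_. step M"]
  by (auto simp: fin_paths_def nth_append simp del: length_append)

lemma fin_paths_nonempty: "p \<in> fin_paths M \<Longrightarrow> p \<noteq> []"
  by (simp add: fin_paths_def)

lemma fin_paths_states:
  assumes "fsm M"
  shows "p \<in> fin_paths M \<Longrightarrow> set p \<subseteq> states M"
proof (induction p rule: rev_induct)
  case (snoc x p)
  show ?case
  proof (cases "p = []")
    case True
    then show ?thesis using snoc.prems assms by (auto simp: fin_paths_singleton fsm_def)
  next
    case False
    then have "set p \<subseteq> states M" "step M (last p) x"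
      using snoc by (auto simp: fin_paths_snoc)
    moreover have "last p \<in> states M" using False calculation by auto
    ultimately show ?thesis using assms by (fastforce simp: fsm_def step_def)
  qed
qed simp

lemma last_fin_paths_states: "fsm M \<Longrightarrow> p \<in> fin_paths M \<Longrightarrow> last p \<in> states M"
  using fin_paths_states fin_paths_nonempty last_in_set by blast

text \<open>The only new pair of consecutive states is the last one.\<close>

lemma consistent_snoc:
  assumes "p \<noteq> []"
  shows "consistent M f (p @ [x]) \<longleftrightarrow>
    consistent M f p \<and> (\<exists>\<sigma> \<in> f p. delta M (last p) \<sigma> = Some {x})"
proof -
  have eq: "\<nu> @ [y, z] = p @ [x] \<longleftrightarrow> \<nu> = butlast p \<and> y = last p \<and> z = x" for \<nu> y z
    using assms by (cases p rule: rev_cases) auto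
  show ?thesis
    using assms unfolding consistent_def Sublist.prefix_snoc eq
    by (metis append_butlast_last_id)
qed

lemma sup_fin_paths_singleton: "[x] \<in> sup_fin_paths M f \<longleftrightarrow> x = start M"
  by (auto simp: sup_fin_paths_def fin_paths_singleton consistent_def Sublist.prefix_def Cons_eq_append_conv)

text \<open>Infinitely many prefixes in \<open>B\<close> are arbitrarily long, and dropping last
  elements reaches every shorter nonempty one. The closure says nothing about the empty list, hence
  \<open>Suc n\<close>.\<close>

lemma Lim_iff_prefix:
  assumes closed: "\<And>p x. p \<noteq> [] \<Longrightarrow> p @ [x] \<in> B \<Longrightarrow> p \<in> B"
  shows "w \<in> Lim B \<longleftrightarrow> (\<forall>n. prefix (Suc n) w \<in> B)"
proof
  assume w: "w \<in> Lim B"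
  have down: "prefix (Suc (n + d)) w \<in> B \<Longrightarrow> prefix (Suc n) w \<in> B" for n d
  proof (induction d)
    case (Suc d)
    then have "prefix (Suc (n + d)) w @ [w (Suc (n + d))] \<in> B"
      by (simp only: prefix_Suc add_Suc_right)
    then show ?case using Suc.IH closed by (metis append_is_Nil_conv not_Cons_self2 prefix_Suc)
  qed simp
  show "\<forall>n. prefix (Suc n) w \<in> B"
  proof
    fix n
    \<comment> \<open>There are finitely many prefixes of length at most \<open>n\<close>, so one in
      \<open>B\<close> must be longer.\<close>
    have "\<not> {v \<in> B. \<exists>m. v = prefix m w} \<subseteq> (\<lambda>m. prefix m w) ` {..n}"
      using w finite_surj [of "{..n}"] by (auto simp: Lim_def)
    then obtain m where "prefix m w \<in> B" "n < m" by force
    then show "prefix (Suc n) w \<in> B"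
      using down [of n "m - Suc n"] by simp
  qed
next
  assume w: "\<forall>n. prefix (Suc n) w \<in> B"
  \<comment> \<open>Prefixes of different lengths are different lists.\<close>
  have "inj (\<lambda>n. prefix (Suc n) w)"
    by (rule injI) (metis length_map length_upt minus_nat.diff_0 nat.inject subsequence_def)
  then have "infinite (range (\<lambda>n. prefix (Suc n) w))"
    using finite_imageD by blast
  moreover have "range (\<lambda>n. prefix (Suc n) w) \<subseteq> {v \<in> B. \<exists>n. v = prefix n w}"
    using w by blast
  ultimately show "w \<in> Lim B"
    unfolding Lim_def using finite_subset by blast
qed

lemma sup_fin_paths_snocD: "p \<noteq> [] \<Longrightarrow> p @ [x] \<in> sup_fin_paths M f \<Longrightarrow> p \<in> sup_fin_paths M f"
  by (simp add: sup_fin_paths_def fin_paths_snoc consistent_snoc)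

lemma sup_inf_paths_iff: "\<pi> \<in> sup_inf_paths M f \<longleftrightarrow> (\<forall>n. prefix (Suc n) \<pi> \<in> sup_fin_paths M f)"
  unfolding sup_inf_paths_def by (rule Lim_iff_prefix) (rule sup_fin_paths_snocD)

lemma sup_inf_paths_subset: "sup_inf_paths M f \<subseteq> inf_paths M"
proof
  fix \<pi> assume "\<pi> \<in> sup_inf_paths M f"
  then have fin: "prefix (Suc n) \<pi> \<in> fin_paths M" for n
    by (auto simp: sup_inf_paths_iff sup_fin_paths_def)
  have "step M (\<pi> n) (\<pi> (Suc n))" for n
  proof -
    have "prefix (Suc n) \<pi> @ [\<pi> (Suc n)] \<in> fin_paths M"
      using fin [of "Suc n"] by (simp only: prefix_Suc)
    then have "step M (last (prefix (Suc n) \<pi>)) (\<pi> (Suc n))"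
      by (subst (asm) fin_paths_snoc) auto
    then show ?thesis by (simp add: prefix_Suc)
  qed
  moreover have "\<pi> 0 = start M"
    using fin [of 0] by (simp add: prefix_Suc fin_paths_singleton)
  ultimately show "\<pi> \<in> inf_paths M" by (simp add: inf_paths_def)
qed

section \<open>Compliant plays of a game graph\<close>

lemma compliant_fin_plays_snoc:
  assumes "\<rho> \<noteq> []"
  shows "\<rho> @ [q] \<in> compliant_fin_plays G h \<longleftrightarrow> \<rho> \<in> compliant_fin_plays G h \<and>
    q \<in> Q0 G \<union> Q1 G \<and> move G (last \<rho>) q \<and> (last \<rho> \<in> Q0 G \<longrightarrow> q = h \<rho>)"
proof -
  have "(\<forall>k. Suc k < length (\<rho> @ [q]) \<longrightarrow> (\<rho> @ [q]) ! k \<in> Q0 G \<longrightarrow>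
        (\<rho> @ [q]) ! Suc k = h (take (Suc k) (\<rho> @ [q]))) \<longleftrightarrow>
      (\<forall>k. Suc k < length \<rho> \<longrightarrow> \<rho> ! k \<in> Q0 G \<longrightarrow> \<rho> ! Suc k = h (take (Suc k) \<rho>)) \<and>
      (last \<rho> \<in> Q0 G \<longrightarrow> q = h \<rho>)"
    \<comment> \<open>The predicate needs its index because compliance refers to the history. Each
      history ends within \<open>\<rho>\<close>, so cutting it from the extended list changes
      nothing.\<close>
    using assms all_Suc_less_snoc [of \<rho> q "\<lambda>k a b. a \<in> Q0 G \<longrightarrow> b = h (take (Suc k) (\<rho> @ [q]))"]
    by (simp add: less_imp_le)
  moreover have "\<rho> @ [q] \<in> fin_plays G \<longleftrightarrow>
      \<rho> \<in> fin_plays G \<and> q \<in> Q0 G \<union> Q1 G \<and> move G (last \<rho>) q"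
    using assms all_Suc_less_snoc [of \<rho> q "\<lambda>_. move G"]
    by (auto simp: fin_plays_def nth_append simp del: length_append)
  ultimately show ?thesis
    unfolding compliant_fin_plays_def mem_Collect_eq conj_imp_eq_imp_imp by blast
qed

text \<open>Compliance is violated, if at all, at a finite stage; facts about infinite plays can
  thus be proved by induction on prefixes.\<close>

lemma compliant_inf_plays_iff:
  "\<rho> \<in> compliant_inf_plays G h \<longleftrightarrow> (\<forall>n. prefix (Suc n) \<rho> \<in> compliant_fin_plays G h)"
proof
  assume "\<rho> \<in> compliant_inf_plays G h"
  then show "\<forall>n. prefix (Suc n) \<rho> \<in> compliant_fin_plays G h"
    by (auto simp: compliant_inf_plays_def compliant_fin_plays_def inf_plays_def fin_plays_def
        subsequence_def take_map simp del: upt_Suc)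
next
  assume fin: "\<forall>n. prefix (Suc n) \<rho> \<in> compliant_fin_plays G h"
  have "\<rho> n \<in> Q0 G \<union> Q1 G \<and> move G (\<rho> n) (\<rho> (Suc n)) \<and>
      (\<rho> n \<in> Q0 G \<longrightarrow> \<rho> (Suc n) = h (prefix (Suc n) \<rho>))" for n
  proof -
    have "prefix (Suc n) \<rho> @ [\<rho> (Suc n)] \<in> compliant_fin_plays G h"
      using fin by (metis prefix_Suc)
    then have "move G (last (prefix (Suc n) \<rho>)) (\<rho> (Suc n)) \<and>
        (last (prefix (Suc n) \<rho>) \<in> Q0 G \<longrightarrow> \<rho> (Suc n) = h (prefix (Suc n) \<rho>))"
      by (subst (asm) compliant_fin_plays_snoc) auto
    moreover have "\<rho> n \<in> set (prefix (Suc n) \<rho>)" by (simp add: prefix_Suc)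
    then have "\<rho> n \<in> Q0 G \<union> Q1 G"
      using fin unfolding compliant_fin_plays_def fin_plays_def by blast
    ultimately show ?thesis by (simp add: prefix_Suc)
  qed
  moreover have "\<rho> 0 = q_init G"
    using fin [rule_format, of 0] by (simp add: prefix_Suc compliant_fin_plays_def fin_plays_def)
  ultimately show "\<rho> \<in> compliant_inf_plays G h"
    by (auto simp: compliant_inf_plays_def inf_plays_def)
qed

text \<open>\<open>strategy0\<close> restricts \<open>h\<close> on histories only; this membership
  is what makes its answers along paths legal.\<close>

lemma play_of_histories:
  assumes "fsm M" "strategy0 (game_of M Euc) h"
  shows "p \<in> fin_paths M \<Longrightarrow> play_of h p \<in> histories (game_of M Euc)"
proof (induction p rule: rev_induct)
  case (snoc x p)
  show ?case
  proof (cases "p = []")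
    case True
    then show ?thesis using snoc.prems histories.init [of "game_of M Euc"]
      by (simp add: fin_paths_singleton game_of_def)
  next
    case False
    then have hist: "play_of h p \<in> histories (game_of M Euc)"
      using snoc by (simp add: fin_paths_snoc)
    moreover have "Inl x \<in> Q0 (game_of M Euc)"
      using fin_paths_states [OF assms(1) snoc.prems] by (simp add: game_of_def)
    ultimately show ?thesis
      using False assms(2) by (auto simp: play_of_snoc strategy0_def intro: histories.ext)
  qed
qed (simp add: fin_paths_def)

section \<open>Supervisors and strategies that match\<close>

text \<open>The equation \<open>answer\<close> is imposed along finite paths only, exactly where a
  supervisor is constrained. One equivalence proved here serves both directions of the theorem, once
  a partner is found for a given supervisor or strategy.\<close>

locale matching =
  fixes M :: "('x, 'e) fsm" and Euc :: "'e set"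
    and f :: "'x list \<Rightarrow> 'e set"
    and h :: "('x + 'x \<times> 'e set) list \<Rightarrow> 'x + 'x \<times> 'e set"
  assumes fsm: "fsm M"
    and det: "deterministic M"
    and sup: "supervisor M Euc f"
    and answer: "p \<in> fin_paths M \<Longrightarrow> h (play_of h p) = Inr (last p, f p)"
begin

abbreviation "G \<equiv> game_of M Euc"

lemma pattern: "p \<in> fin_paths M \<Longrightarrow> f p \<in> control_patterns (events M) Euc"
  using sup by (simp add: supervisor_def)

text \<open>Player 1 moves to a member of a transition set, whereas consistency asks for a
  singleton; determinism, applied to the events of the control pattern, identifies the two.\<close>

lemma enabled_iff:
  assumes "p \<in> fin_paths M"
  shows "(\<exists>\<sigma> \<in> f p. \<exists>S. delta M (last p) \<sigma> = Some S \<and> x \<in> S) \<longleftrightarrow>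
    (\<exists>\<sigma> \<in> f p. delta M (last p) \<sigma> = Some {x})"
proof -
  have "S = {x}" if "\<sigma> \<in> f p" "delta M (last p) \<sigma> = Some S" "x \<in> S" for \<sigma> S
  proof -
    have "\<sigma> \<in> events M" using that(1) pattern [OF assms] by (auto simp: control_patterns_def)
    then have "\<exists>y. S = {y}"
      using det last_fin_paths_states [OF fsm assms] that(2) by (simp add: deterministic_def)
    then show ?thesis using that(3) by auto
  qed
  then show ?thesis by blast
qed

text \<open>The \<open>step\<close> condition is absorbed: the events of \<open>f p\<close> are
  events of \<open>M\<close>, so a target that \<open>f p\<close> enables is reached by a
  step.\<close>

lemma sup_fin_paths_snoc:
  assumes "p \<noteq> []"
  shows "p @ [x] \<in> sup_fin_paths M f \<longleftrightarrow>
    p \<in> sup_fin_paths M f \<and> (\<exists>\<sigma> \<in> f p. delta M (last p) \<sigma> = Some {x})"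
  using assms pattern [of p]
  by (fastforce simp: sup_fin_paths_def fin_paths_snoc consistent_snoc step_def control_patterns_def)

lemma sup_fin_path: "p \<in> sup_fin_paths M f \<Longrightarrow> p \<in> fin_paths M"
  by (simp add: sup_fin_paths_def)

text \<open>The play ends at \<open>Inl (last p)\<close>, where compliance leaves one choice, and
  that choice is a legal move because \<open>f p\<close> is a control pattern.\<close>

lemma compliant_answer_iff:
  assumes p: "p \<in> fin_paths M"
  shows "play_of h p @ [q] \<in> compliant_fin_plays G h \<longleftrightarrow>
    play_of h p \<in> compliant_fin_plays G h \<and> q = h (play_of h p)"
proof -
  have "p \<noteq> []" using p by (rule fin_paths_nonempty)
  then show ?thesis
    using pattern [OF p] last_fin_paths_states [OF fsm p]
    by (auto simp: compliant_fin_plays_snoc play_of_nonempty last_play_of answer [OF p] move_def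
        game_of_def)
qed

text \<open>At \<open>Inr (last p, f p)\<close> compliance does not restrict player 1, whose options
  are the targets enabled by the supervisor.\<close>

lemma compliant_move_iff:
  assumes p: "p \<in> fin_paths M"
  shows "play_of h p @ [h (play_of h p), q] \<in> compliant_fin_plays G h \<longleftrightarrow>
    play_of h p \<in> compliant_fin_plays G h \<and>
    (\<exists>x. q = Inl x \<and> (\<exists>\<sigma> \<in> f p. delta M (last p) \<sigma> = Some {x}))"
proof -
  have "p \<noteq> []" using p by (rule fin_paths_nonempty)
  have closed: "x \<in> states M" if "\<sigma> \<in> f p" "delta M (last p) \<sigma> = Some {x}" for \<sigma> x
    using that fsm pattern [OF p] last_fin_paths_states [OF fsm p]
    by (fastforce simp: fsm_def control_patterns_def)
  have mv: "move G (Inr (last p, f p)) q \<longleftrightarrow>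
      (\<exists>x. q = Inl x \<and> (\<exists>\<sigma> \<in> f p. delta M (last p) \<sigma> = Some {x}))"
    using pattern [OF p] last_fin_paths_states [OF fsm p]
    unfolding enabled_iff [OF p, symmetric] by (auto simp: move_def game_of_def)
  have "Inr (last p, f p) \<notin> Q0 G" by (auto simp: game_of_def)
  then show ?thesis
    using compliant_fin_plays_snoc [of "play_of h p @ [h (play_of h p)]" q G h] closed
      compliant_answer_iff [OF p, of "h (play_of h p)"]
    by (auto simp: answer [OF p] mv) (auto simp: game_of_def)
qed

lemma play_of_compliant: "p \<in> sup_fin_paths M f \<Longrightarrow> play_of h p \<in> compliant_fin_plays G h"
proof (induction p rule: rev_induct)
  case Nil
  then show ?case by (simp add: sup_fin_paths_def fin_paths_def)
next
  case (snoc x p)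
  show ?case
  proof (cases "p = []")
    case True
    then show ?thesis
      using snoc.prems fsm
      by (auto simp: sup_fin_paths_singleton compliant_fin_plays_def fin_plays_def game_of_def fsm_def)
  next
    case False
    then show ?thesis
      using snoc by (auto simp: sup_fin_paths_snoc play_of_snoc compliant_move_iff sup_fin_path)
  qed
qed

text \<open>The cases record whose turn it is. The induction passes from the first to the second by
  \<open>compliant_answer_iff\<close> and back by \<open>compliant_move_iff\<close>.\<close>

lemma compliant_fin_play_cases:
  assumes "\<rho> \<in> compliant_fin_plays G h"
  obtains p where "p \<in> sup_fin_paths M f" "\<rho> = play_of h p"
  | p where "p \<in> sup_fin_paths M f" "\<rho> = play_of h p @ [h (play_of h p)]"
proof -
  have "\<exists>p \<in> sup_fin_paths M f. \<rho> = play_of h p \<or> \<rho> = play_of h p @ [h (play_of h p)]"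
    using assms
  proof (induction \<rho> rule: rev_induct)
    case Nil
    then show ?case by (simp add: compliant_fin_plays_def fin_plays_def)
  next
    case (snoc q \<rho>)
    show ?case
    proof (cases "\<rho> = []")
      case True
      then have "q = Inl (start M)"
        using snoc.prems by (simp add: compliant_fin_plays_def fin_plays_def game_of_def)
      then show ?thesis
        using True by (intro bexI [of _ "[start M]"]) (auto simp: sup_fin_paths_singleton)
    next
      case False
      then have "\<rho> \<in> compliant_fin_plays G h"
        using snoc.prems by (simp add: compliant_fin_plays_snoc)
      then obtain p where p: "p \<in> sup_fin_paths M f"
        and \<rho>: "\<rho> = play_of h p \<or> \<rho> = play_of h p @ [h (play_of h p)]"
        using snoc.IH by auto
      have path: "p \<in> fin_paths M" using p by (rule sup_fin_path)
      show ?thesis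
        using \<rho>
      proof
        assume "\<rho> = play_of h p"
        then have "q = h (play_of h p)"
          using snoc.prems compliant_answer_iff [OF path] by simp
        then show ?thesis using \<open>\<rho> = play_of h p\<close> p by blast
      next
        assume \<rho>: "\<rho> = play_of h p @ [h (play_of h p)]"
        then obtain x where "q = Inl x" "\<exists>\<sigma> \<in> f p. delta M (last p) \<sigma> = Some {x}"
          using snoc.prems compliant_move_iff [OF path] by auto
        then show ?thesis
          using p \<rho> fin_paths_nonempty [OF path]
          by (intro bexI [of _ "p @ [x]"]) (auto simp: play_of_snoc sup_fin_paths_snoc)
      qed
    qed
  qed
  then show ?thesis using that by blast
qed

text \<open>Makes \<open>play_of h\<close> injective on finite paths; the answers there are in the
  \<open>Inr\<close> summand and get filtered out.\<close>

lemma path_of_play_of: "p \<in> fin_paths M \<Longrightarrow> path_of (play_of h p) = p"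
proof (induction p rule: rev_induct)
  case (snoc x p)
  then show ?case
    by (cases "p = []") (auto simp: play_of_snoc path_of_def fin_paths_snoc answer)
qed (simp add: fin_paths_def)

lemma inf_play_of_compliant:
  assumes "\<pi> \<in> sup_inf_paths M f"
  shows "inf_play_of h \<pi> \<in> compliant_inf_plays G h"
  unfolding compliant_inf_plays_iff
proof
  fix n
  have fin: "prefix (Suc k) \<pi> \<in> sup_fin_paths M f" for k
    using assms by (simp add: sup_inf_paths_iff)
  consider k where "Suc n = Suc (2 * k)" | k where "Suc n = 2 * Suc k"
    by (cases "even n") (auto elim!: evenE oddE)
  then show "prefix (Suc n) (inf_play_of h \<pi>) \<in> compliant_fin_plays G h"
  proof cases
    case 1
    then show ?thesis
      using play_of_compliant [OF fin] prefix_inf_play_of_odd by metis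
  next
    case 2
    then show ?thesis
      using play_of_compliant [OF fin] prefix_inf_play_of_even
        compliant_answer_iff [OF sup_fin_path [OF fin]] by metis
  qed
qed

lemma compliant_inf_play_cases:
  assumes "\<rho> \<in> compliant_inf_plays G h"
  obtains \<pi> where "\<pi> \<in> sup_inf_paths M f" "\<rho> = inf_play_of h \<pi>"
proof -
  \<comment> \<open>The unspecified values of \<open>projl\<close> never show: by the invariant
    below, even positions carry \<open>Inl\<close> states.\<close>
  define \<pi> where "\<pi> k = projl (\<rho> (2 * k))" for k
  have fin: "prefix (Suc n) \<rho> \<in> compliant_fin_plays G h" for n
    using assms by (simp add: compliant_inf_plays_iff)
  \<comment> \<open>Both claims go together: the answer at position \<open>Suc (2 * k)\<close> can
    be identified only once the prefix before it is known to be the play of a path of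
    \<open>M\<close>.\<close>
  have inv: "prefix (Suc k) \<pi> \<in> sup_fin_paths M f \<and>
      prefix (Suc (2 * k)) \<rho> = play_of h (prefix (Suc k) \<pi>)" for k
  proof (induction k)
    case 0
    have "\<rho> 0 = Inl (start M)"
      using fin [of 0] by (simp add: prefix_Suc compliant_fin_plays_def fin_plays_def game_of_def)
    then show ?case by (simp add: prefix_Suc sup_fin_paths_singleton \<pi>_def)
  next
    case (Suc k)
    let ?p = "prefix (Suc k) \<pi>"
    have p: "?p \<in> sup_fin_paths M f" "?p \<in> fin_paths M" "?p \<noteq> []"
      and \<rho>: "prefix (Suc (2 * k)) \<rho> = play_of h ?p"
      using Suc by (auto simp: sup_fin_path)
    have "play_of h ?p @ [\<rho> (Suc (2 * k))] \<in> compliant_fin_plays G h"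
      using fin [of "Suc (2 * k)"] by (metis \<rho> prefix_Suc)
    then have odd: "\<rho> (Suc (2 * k)) = h (play_of h ?p)"
      using compliant_answer_iff [OF p(2)] by blast
    have ext: "prefix (Suc (2 * Suc k)) \<rho> = play_of h ?p @ [h (play_of h ?p), \<rho> (2 * Suc k)]"
      using \<rho> odd prefix_Suc [of \<rho> "Suc (2 * k)"] prefix_Suc [of \<rho> "2 * Suc k"] by simp
    then obtain x where x: "\<rho> (2 * Suc k) = Inl x" "\<exists>\<sigma> \<in> f ?p. delta M (last ?p) \<sigma> = Some {x}"
      using fin [of "2 * Suc k"] compliant_move_iff [OF p(2)] by auto
    then have "prefix (Suc (Suc k)) \<pi> = ?p @ [x]"
      using prefix_Suc [of \<pi> "Suc k"] by (simp add: \<pi>_def)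
    then show ?case
      using p x ext sup_fin_paths_snoc [OF p(3)] play_of_snoc [OF p(3)] by metis
  qed
  have "\<rho> n = inf_play_of h \<pi> n" for n
  proof -
    \<comment> \<open>A prefix of this length contains position \<open>n\<close>, whatever its
      parity.\<close>
    have "prefix (Suc (2 * n)) \<rho> = prefix (Suc (2 * n)) (inf_play_of h \<pi>)"
      using inv by (simp add: prefix_inf_play_of_odd)
    then have "prefix (Suc (2 * n)) \<rho> ! n = prefix (Suc (2 * n)) (inf_play_of h \<pi>) ! n" by simp
    then show ?thesis by (simp add: subsequence_def del: upt_Suc)
  qed
  then show ?thesis using inv that [of \<pi>] by (auto simp: sup_inf_paths_iff)
qed

lemma compliant_inf_plays_eq: "compliant_inf_plays G h = inf_play_of h ` sup_inf_paths M f"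
  using inf_play_of_compliant compliant_inf_play_cases by blast

lemma not_isl_answer:
  "\<pi> \<in> sup_inf_paths M f \<Longrightarrow> \<not> isl (h (play_of h (prefix (Suc k) \<pi>)))"
  by (simp add: sup_inf_paths_iff sup_fin_path answer)

text \<open>Turns \<open>Pre\<close> on plays into \<open>Pre\<close> on paths. If the path
  continues \<open>p\<close>, its play also contains the next answer, since \<open>h\<close>
  produces both from the same states.\<close>

lemma prefix_play_iff:
  assumes p: "p \<in> sup_fin_paths M f" and \<pi>: "\<pi> \<in> sup_inf_paths M f"
  shows "(\<exists>n. play_of h p = prefix n (inf_play_of h \<pi>)) \<longleftrightarrow> (\<exists>n. p = prefix n \<pi>)"
    and "(\<exists>n. p = prefix n \<pi>) \<Longrightarrow> \<exists>n. play_of h p @ [h (play_of h p)] = prefix n (inf_play_of h \<pi>)"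
proof -
  have "p \<noteq> []" using p sup_fin_path fin_paths_nonempty by blast
  then have pos: "\<exists>k. n = Suc k" if "p = prefix n \<pi>" for n
    using that by (cases n) auto
  show "\<exists>n. play_of h p @ [h (play_of h p)] = prefix n (inf_play_of h \<pi>)" if "\<exists>n. p = prefix n \<pi>"
    using that pos prefix_inf_play_of_even by metis
  show "(\<exists>n. play_of h p = prefix n (inf_play_of h \<pi>)) \<longleftrightarrow> (\<exists>n. p = prefix n \<pi>)"
  proof
    assume "\<exists>n. p = prefix n \<pi>"
    then show "\<exists>n. play_of h p = prefix n (inf_play_of h \<pi>)"
      using pos prefix_inf_play_of_odd by metis
  next
    assume "\<exists>n. play_of h p = prefix n (inf_play_of h \<pi>)"
    then obtain n where n: "play_of h p = prefix n (inf_play_of h \<pi>)" ..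
    obtain k where "length p = Suc k" using \<open>p \<noteq> []\<close> by (cases p) auto
    \<comment> \<open>Comparing lengths leaves one candidate for \<open>n\<close>; injectivity of
      \<open>play_of h\<close> on paths then finishes.\<close>
    then have "n = Suc (2 * k)"
      using length_play_of [OF \<open>p \<noteq> []\<close>, of h] n by simp
    then have "play_of h p = play_of h (prefix (Suc k) \<pi>)"
      using n by (simp only: prefix_inf_play_of_odd)
    moreover have "prefix (Suc k) \<pi> \<in> fin_paths M"
      using \<pi> by (simp add: sup_inf_paths_iff sup_fin_path)
    ultimately have "p = prefix (Suc k) \<pi>"
      using path_of_play_of p sup_fin_path by metis
    then show "\<exists>n. p = prefix n \<pi>" ..
  qed
qed

text \<open>The disjunction of \<open>rabin FP\<close> and \<open>rabin FS\<close> is the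
  implication from \<open>streett FP\<close> to \<open>rabin FS\<close>, taken over all supervised
  paths.\<close>

lemma rabin_condition_iff:
  "(\<forall>\<rho> \<in> compliant_inf_plays G h. rabin (lift_cond (FP \<union> FS)) \<rho>) \<longleftrightarrow>
   sup_inf_paths M f \<inter> {\<pi> \<in> inf_paths M. streett FP \<pi>} \<subseteq> {\<pi> \<in> inf_paths M. rabin FS \<pi>}"
  using sup_inf_paths_subset [of M f] rabin_inf_play_of [of h, OF not_isl_answer]
  by (auto simp: compliant_inf_plays_eq rabin_Un streett_iff_not_rabin)

text \<open>A play ending in an answer imposes nothing beyond the play without it: every compliant
  infinite play through the latter gives the same answer.\<close>

lemma Pre_condition_iff:
  "compliant_fin_plays G h \<subseteq> Pre {\<rho> \<in> compliant_inf_plays G h. streett (lift_cond FP) \<rho>} \<longleftrightarrow>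
   sup_fin_paths M f \<subseteq> Pre (sup_inf_paths M f \<inter> {\<pi> \<in> inf_paths M. streett FP \<pi>})"
proof -
  let ?A = "{\<pi> \<in> sup_inf_paths M f. streett FP \<pi>}"
  have A: "sup_inf_paths M f \<inter> {\<pi> \<in> inf_paths M. streett FP \<pi>} = ?A"
    using sup_inf_paths_subset [of M f] by blast
  have B: "{\<rho> \<in> compliant_inf_plays G h. streett (lift_cond FP) \<rho>} = inf_play_of h ` ?A"
    using streett_inf_play_of [of h, OF not_isl_answer] by (auto simp: compliant_inf_plays_eq)
  have Pre_iff: "play_of h p \<in> Pre (inf_play_of h ` ?A) \<longleftrightarrow> p \<in> Pre ?A"
    if "p \<in> sup_fin_paths M f" for p
    using prefix_play_iff(1) [OF that] by (fastforce simp: Pre_def)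
  have Pre_answer: "play_of h p @ [h (play_of h p)] \<in> Pre (inf_play_of h ` ?A)"
    if "p \<in> sup_fin_paths M f" "p \<in> Pre ?A" for p
    using that prefix_play_iff(2) [OF that(1)] by (fastforce simp: Pre_def)
  show ?thesis
    unfolding A B
    using Pre_iff Pre_answer play_of_compliant by (blast elim: compliant_fin_play_cases)
qed

lemma supervisor_iff_strategy:
  "({} \<subset> sup_inf_paths M f \<inter> {\<pi> \<in> inf_paths M. streett FP \<pi>} \<and>
    sup_inf_paths M f \<inter> {\<pi> \<in> inf_paths M. streett FP \<pi>} \<subseteq> {\<pi> \<in> inf_paths M. rabin FS \<pi>} \<and>
    sup_fin_paths M f \<subseteq> Pre (sup_inf_paths M f \<inter> {\<pi> \<in> inf_paths M. streett FP \<pi>})) \<longleftrightarrow>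
   ((\<forall>\<rho> \<in> compliant_inf_plays G h. rabin (lift_cond (FP \<union> FS)) \<rho>) \<and>
    (\<forall>\<rho> \<in> compliant_fin_plays G h.
       \<rho> \<in> Pre {\<rho>' \<in> compliant_inf_plays G h. streett (lift_cond FP) \<rho>'}))"
proof -
  \<comment> \<open>Nonemptiness has no counterpart on the side of the strategy. It follows from the
    inclusion in \<open>Pre A\<close>, because \<open>[start M]\<close> is always consistent and can
    be a prefix only of an existing member of \<open>A\<close>.\<close>
  have "[start M] \<in> sup_fin_paths M f" by (simp add: sup_fin_paths_singleton)
  then have "sup_fin_paths M f \<subseteq> Pre A \<Longrightarrow> {} \<subset> A" for A
    by (auto simp: Pre_def)
  then show ?thesis
    using rabin_condition_iff Pre_condition_iff unfolding subset_eq [of "compliant_fin_plays G h"]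
    by blast
qed

end

section \<open>Existence of matching partners, and the equivalence\<close>

text \<open>The answer is computed by forgetting the player-1 states of the history and asking
  \<open>f\<close>; so \<open>h\<close> does not refer to \<open>play_of h\<close>, and no
  circularity arises.\<close>

lemma matching_strategy_exists:
  assumes "fsm M" "deterministic M" "Euc \<subseteq> events M" "supervisor M Euc f"
  shows "\<exists>h. strategy0 (game_of M Euc) h \<and> matching M Euc f h"
proof -
  let ?C = "control_patterns (events M) Euc"
  \<comment> \<open>A history need not project to a path, and there \<open>f\<close> may fail to be a control pattern.\<close>
  define f' where "f' p = (if f p \<in> ?C then f p else events M)" for p
  define h :: "('a + 'a \<times> 'b set) list \<Rightarrow> 'a + 'a \<times> 'b set"
    where "h s = Inr (projl (last s), f' (path_of s))" for s
  have f': "f' p \<in> ?C" for p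
    using assms(3) by (auto simp: f'_def control_patterns_def)
  \<comment> \<open>Histories end in a player-0 state, so \<open>projl\<close> in \<open>h\<close>
    is applied to a genuine \<open>Inl\<close>.\<close>
  have "\<exists>x \<in> states M. last s = Inl x" if "s \<in> histories (game_of M Euc)" for s
    using that assms(1) by cases (auto simp: game_of_def fsm_def)
  then have "strategy0 (game_of M Euc) h"
    using f' by (fastforce simp: strategy0_def h_def game_of_def)
  \<comment> \<open>This holds for every list, and before \<open>matching\<close> is established,
    because this \<open>h\<close> always answers with an \<open>Inr\<close>.\<close>
  moreover have path: "path_of (play_of h p) = p" for p
  proof (induction p rule: rev_induct)
    case Nil
    then show ?case by (simp add: play_of_def path_of_def)
  next
    case (snoc x p)
    then show ?case
      by (cases "p = []") (auto simp: play_of_snoc path_of_def h_def)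
  qed
  have "h (play_of h p) = Inr (last p, f p)" if "p \<in> fin_paths M" for p
  proof -
    have "f' p = f p" using that assms(4) by (simp add: f'_def supervisor_def)
    then show ?thesis
      using path [of p] last_play_of [OF fin_paths_nonempty [OF that], of h]
      by (simp add: h_def)
  qed
  then have "matching M Euc f h"
    using assms by unfold_locales
  ultimately show ?thesis by blast
qed

text \<open>The supervisor is read off the answers along paths. \<open>strategy0\<close> puts the
  answer into \<open>\<delta>0\<close> of \<open>Inl (last p)\<close>, which fixes its first
  component and makes the second a control pattern.\<close>

lemma matching_supervisor_exists:
  assumes "fsm M" "deterministic M" "strategy0 (game_of M Euc) h"
  shows "\<exists>f. supervisor M Euc f \<and> matching M Euc f h"
proof -
  \<comment> \<open>Off the finite paths the value may be arbitrary; nothing is asked of a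
    supervisor there.\<close>
  define f where "f p = snd (projr (h (play_of h p)))" for p
  have ans: "h (play_of h p) \<in> Inr ` ({last p} \<times> control_patterns (events M) Euc)"
    if "p \<in> fin_paths M" for p
    using play_of_histories [OF assms(1,3) that] assms(3) fin_paths_nonempty [OF that]
    by (auto simp: strategy0_def game_of_def last_play_of)
  have "supervisor M Euc f"
    using ans by (fastforce simp: supervisor_def f_def)
  moreover have "h (play_of h p) = Inr (last p, f p)" if "p \<in> fin_paths M" for p
    using ans [OF that] by (auto simp: f_def)
  ultimately show ?thesis
    using assms(1,2) by (auto simp: matching_def)
qed

theorem theorem3:
  fixes M :: "('x, 'e) fsm"
    and Ec Euc :: "'e set"
    and FP FS :: "'x acc_cond"
  assumes "fsm M"
    and "deterministic M"
    and "events M = Ec \<union> Euc"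
    and "Ec \<inter> Euc = {}"
    and "\<forall>x \<in> states M. \<forall>\<sigma> \<in> events M. \<forall>\<sigma>' \<in> events M.
           delta M x \<sigma> \<noteq> None \<and> delta M x \<sigma>' \<noteq> None \<and> delta M x \<sigma> = delta M x \<sigma>' \<longrightarrow> \<sigma> = \<sigma>'"
    and "cond_over (states M) FP"
    and "cond_over (states M) FS"
  shows
    "(\<exists>f. supervisor M Euc f \<and>
        {} \<subset> sup_inf_paths M f \<inter> {\<pi> \<in> inf_paths M. streett FP \<pi>} \<and>
        sup_inf_paths M f \<inter> {\<pi> \<in> inf_paths M. streett FP \<pi>} \<subseteq> {\<pi> \<in> inf_paths M. rabin FS \<pi>} \<and>
        sup_fin_paths M f \<subseteq> Pre (sup_inf_paths M f \<inter> {\<pi> \<in> inf_paths M. streett FP \<pi>}))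
     \<longleftrightarrow>
     (\<exists>h. strategy0 (game_of M Euc) h \<and>
        (\<forall>\<rho> \<in> compliant_inf_plays (game_of M Euc) h. rabin (lift_cond (FP \<union> FS)) \<rho>) \<and>
        (\<forall>\<rho> \<in> compliant_fin_plays (game_of M Euc) h.
           \<rho> \<in> Pre {\<rho>' \<in> compliant_inf_plays (game_of M Euc) h. streett (lift_cond FP) \<rho>'}))"
  (is "(\<exists>f. supervisor M Euc f \<and> ?win f) \<longleftrightarrow> (\<exists>h. strategy0 (game_of M Euc) h \<and> ?win' h)"
    is "?L \<longleftrightarrow> ?R")
proof -
  have Euc: "Euc \<subseteq> events M" using assms(3) by blast
  show ?thesis
  proof
    assume ?L
    then obtain f where f: "supervisor M Euc f" and win: "?win f" by blast
    then obtain h where "strategy0 (game_of M Euc) h" "matching M Euc f h"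
      using matching_strategy_exists [OF assms(1,2) Euc] by blast
    then show ?R
      using matching.supervisor_iff_strategy [of M Euc f h FP FS] win by blast
  next
    assume ?R
    then obtain h where h: "strategy0 (game_of M Euc) h" and win: "?win' h" by blast
    then obtain f where "supervisor M Euc f" "matching M Euc f h"
      using matching_supervisor_exists [OF assms(1,2)] by blast
    then show ?L
      using matching.supervisor_iff_strategy [of M Euc f h FP FS] win by blast
  qed
qed

end
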